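(* Let $n\ge1$ and let $M$ be a real-valued functional defined on the nonempty subsets of $\{1,\dots,n\}$ which satisfies the Averaging Property. Let $(S_j)_j$ be the partition of $\{1,\dots,n\}$ into consecutive intervals obtained at the end of the PAVA applied to $M$. For each $i\in\{1,\dots,n\}$ let $j_i$ be the index such that $i\in S_{j_i}$, and put $m_i=M(S_{j_i})$. Then for every $i\in\{1,\dots,n\}$, $$m_i=\max_{s\le i}\ \min_{t\ge i}\ M(\{s,\dots,t\}),$$ where $s$ ranges over $\{1,\dots,i\}$ and $t$ over $\{i,\dots,n\}$.
   Context: Averaging Property: for any (nonempty) sets $A,B\subseteq\{1,\dots,n\}$ with $A\cap B=\emptyset$, $\min\{M(A),M(B)\}\le M(A\cup B)\le\max\{M(A),M(B)\}$. PAVA (pool-adjacent-violators algorithm) for a set functional $M$: at every step the current configuration is a subdivision of $\{1,\dots,n\}$ into $k$ consecutive intervals $S_1=\{1,\dots,i_1\}$, $S_2=\{i_1+1,\dots,i_2\}$, ..., $S_k=\{i_{k-1}+1,\dots,n\}$ with $0=i_0<i_1<\dots<i_{k-1}<i_k=n$. The initial configuration is the finest subdivision, $S_j=\{j\}$ for $j=1,\dots,n$. At every step, a violation is an index $j$ with $M(S_j)>M(S_{j+1})$. If there is at least one violation, take the one with the smallest $j$ and merge $S_j$ and $S_{j+1}$ into one interval, which gives a new subdivision with one set fewer; then repeat. The algorithm stops when there are no violations left (this occurs after finitely many steps). *)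

theory Defs
  imports Complex_Main
begin

text \<open>
  A set functional is a total function on sets of naturals; only its values on nonempty
  subsets of \<open>{1..n}\<close> matter below.
\<close>

definition averaging_property :: "nat \<Rightarrow> (nat set \<Rightarrow> real) \<Rightarrow> bool" where
  "averaging_property n M \<longleftrightarrow>
     (\<forall>A B. A \<subseteq> {1..n} \<longrightarrow> B \<subseteq> {1..n} \<longrightarrow> A \<noteq> {} \<longrightarrow> B \<noteq> {} \<longrightarrow> A \<inter> B = {} \<longrightarrow>
        min (M A) (M B) \<le> M (A \<union> B) \<and> M (A \<union> B) \<le> max (M A) (M B))"

text \<open>
  A configuration \<open>S\<^sub>1, \<dots>, S\<^sub>k\<close> is the list of its intervals in increasing order. List positions
  start at 0, so \<open>S\<^sub>j\<close> is at position \<open>j - 1\<close>.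
\<close>

definition violation :: "(nat set \<Rightarrow> real) \<Rightarrow> nat set list \<Rightarrow> nat \<Rightarrow> bool" where
  "violation M S j \<longleftrightarrow> Suc j < length S \<and> M (S ! j) > M (S ! Suc j)"

definition merge_at :: "nat set list \<Rightarrow> nat \<Rightarrow> nat set list" where
  "merge_at S j = take j S @ (S ! j \<union> S ! Suc j) # drop (Suc (Suc j)) S"

lemma length_merge_at: "Suc j < length S \<Longrightarrow> Suc (length (merge_at S j)) = length S"
  by (simp add: merge_at_def)

function pava_from :: "(nat set \<Rightarrow> real) \<Rightarrow> nat set list \<Rightarrow> nat set list" where
  "pava_from M S =
     (if \<exists>j. violation M S j then pava_from M (merge_at S (LEAST j. violation M S j)) else S)"
  by pat_completeness auto
termination
proof (relation "measure (\<lambda>(M, S). length S)")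
  fix M :: "nat set \<Rightarrow> real" and S
  assume "\<exists>j. violation M S j"
  then have "violation M S (LEAST j. violation M S j)"
    by (rule LeastI_ex)
  then have "Suc (LEAST j. violation M S j) < length S"
    by (simp add: violation_def)
  from length_merge_at[OF this]
  show "((M, merge_at S (LEAST j. violation M S j)), (M, S)) \<in> measure (\<lambda>(M, S). length S)"
    by simp
qed simp

declare pava_from.simps [simp del]

definition initial_config :: "nat \<Rightarrow> nat set list" where
  "initial_config n = map (\<lambda>j. {j}) [1..<Suc n]"

definition pava :: "nat \<Rightarrow> (nat set \<Rightarrow> real) \<Rightarrow> nat set list" where
  "pava n M = pava_from M (initial_config n)"

definition block_index :: "nat set list \<Rightarrow> nat \<Rightarrow> nat" where
  "block_index S i = (THE j. j < length S \<and> i \<in> S ! j)"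

definition pava_value :: "nat \<Rightarrow> (nat set \<Rightarrow> real) \<Rightarrow> nat \<Rightarrow> real" where
  "pava_value n M i = M (pava n M ! block_index (pava n M) i)"

end

theory Submission
  imports Defs
begin

text \<open>
  Every block of every PAVA configuration is balanced: each of its proper initial segments has an
  \<open>M\<close>-value at least that of the complementary final segment, and merging at a violation preserves
  this. In the final configuration the block values increase. Let \<open>{a..b}\<close> be the final block
  containing \<open>i\<close>. For \<open>t \<ge> i\<close>, the interval \<open>{a..t}\<close> is composed of whole blocks and an initial
  segment of a block, all of value at least \<open>M {a..b}\<close>; for \<open>s \<le> i\<close>, the interval \<open>{s..b}\<close> is
  composed of a final segment of a block and whole blocks, all of value at most \<open>M {a..b}\<close>.
\<close>

section \<open>Averaging and balanced intervals\<close>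

lemma averaging_property_ivl:
  assumes "averaging_property n M" "1 \<le> a" "a < c" "c < b" "b \<le> Suc n"
  shows "min (M {a..<c}) (M {c..<b}) \<le> M {a..<b}"
    and "M {a..<b} \<le> max (M {a..<c}) (M {c..<b})"
proof -
  have "{a..<c} \<union> {c..<b} = {a..<b}"
    using assms by auto
  moreover have "{a..<c} \<subseteq> {1..n}" "{c..<b} \<subseteq> {1..n}" "{a..<c} \<noteq> {}" "{c..<b} \<noteq> {}"
      "{a..<c} \<inter> {c..<b} = {}"
    using assms by auto
  ultimately show "min (M {a..<c}) (M {c..<b}) \<le> M {a..<b}"
      and "M {a..<b} \<le> max (M {a..<c}) (M {c..<b})"
    using assms(1) unfolding averaging_property_def by metis+
qed

text \<open>Half-open intervals let the two pieces share the cut \<open>c\<close>, and the strict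
  bounds on \<open>c\<close> keep both pieces nonempty.\<close>

definition balanced :: "(nat set \<Rightarrow> real) \<Rightarrow> nat \<Rightarrow> nat \<Rightarrow> bool" where
  "balanced M a b \<longleftrightarrow> (\<forall>c. a < c \<longrightarrow> c < b \<longrightarrow> M {c..<b} \<le> M {a..<c})"

text \<open>By averaging, the whole is at most the larger of the two pieces, and balance makes the
  initial piece the larger one.\<close>

lemma balanced_prefix_ge:
  assumes "averaging_property n M" "balanced M a b" "1 \<le> a" "a < c" "c \<le> b" "b \<le> Suc n"
  shows "M {a..<b} \<le> M {a..<c}"
proof (cases "c = b")
  case False
  then have "c < b" using assms(5) by simp
  then have "M {c..<b} \<le> M {a..<c}" "M {a..<b} \<le> max (M {a..<c}) (M {c..<b})"
    using assms averaging_property_ivl(2)[of n M a c b] by (simp_all add: balanced_def)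
  then show ?thesis by linarith
qed simp

lemma balanced_suffix_le:
  assumes "averaging_property n M" "balanced M a b" "1 \<le> a" "a \<le> c" "c < b" "b \<le> Suc n"
  shows "M {c..<b} \<le> M {a..<b}"
proof (cases "a = c")
  case False
  then have "a < c" using assms(4) by simp
  then have "M {c..<b} \<le> M {a..<c}" "min (M {a..<c}) (M {c..<b}) \<le> M {a..<b}"
    using assms averaging_property_ivl(1)[of n M a c b] by (simp_all add: balanced_def)
  then show ?thesis by linarith
qed simp

lemma balanced_merge:
  assumes avg: "averaging_property n M"
    and P: "balanced M a c" and Q: "balanced M c b"
    and le: "M {c..<b} \<le> M {a..<c}"
    and ord: "1 \<le> a" "a < c" "c < b" "b \<le> Suc n"
  shows "balanced M a b"
  unfolding balanced_def
proof (intro allI impI)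
  fix d assume d: "a < d" "d < b"
  consider "d < c" | "d = c" | "c < d" by linarith
  then show "M {d..<b} \<le> M {a..<d}"
  proof cases
    \<comment> \<open>Averaging bounds \<open>M {d..<b}\<close> by the larger of two values, each at
      most \<open>M {a..<d}\<close>: the first by balance on the left, the second through
      \<open>M {c..<b} \<le> M {a..<c}\<close>.\<close>
    case 1
    then have "M {d..<c} \<le> M {a..<d}"
      using P d by (simp add: balanced_def)
    moreover have "M {a..<c} \<le> M {a..<d}"
      using 1 d ord balanced_prefix_ge[OF avg P] by simp
    moreover have "M {d..<b} \<le> max (M {d..<c}) (M {c..<b})"
      using 1 d ord averaging_property_ivl(2)[OF avg] by simp
    ultimately show ?thesis using le by linarith
  next
    case 2
    then show ?thesis using le by simp
  next
    \<comment> \<open>Mirror image: \<open>M {d..<b}\<close> is at most both values whose minimum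
      bounds \<open>M {a..<d}\<close> from below; the comparison with \<open>M {a..<c}\<close>
      passes through \<open>M {c..<b}\<close>.\<close>
    case 3
    then have "M {d..<b} \<le> M {c..<d}"
      using Q d by (simp add: balanced_def)
    moreover have "M {d..<b} \<le> M {c..<b}"
      using 3 d ord balanced_suffix_le[OF avg Q] by simp
    moreover have "min (M {a..<c}) (M {c..<d}) \<le> M {a..<d}"
      using 3 d ord averaging_property_ivl(1)[OF avg] by simp
    ultimately show ?thesis using le by linarith
  qed
qed

section \<open>Tilings as the invariant of PAVA\<close>

text \<open>Free endpoints allow a configuration to be cut at any block boundary, and
  \<open>c > a\<close> keeps every block nonempty.\<close>

fun tiling :: "(nat set \<Rightarrow> real) \<Rightarrow> nat \<Rightarrow> nat set list \<Rightarrow> nat \<Rightarrow> bool" where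
  "tiling M a [] b \<longleftrightarrow> a = b"
| "tiling M a (B # S) b \<longleftrightarrow> (\<exists>c>a. B = {a..<c} \<and> balanced M a c \<and> tiling M c S b)"

lemma tiling_append:
  "tiling M a (S @ T) b \<longleftrightarrow> (\<exists>c. tiling M a S c \<and> tiling M c T b)"
  by (induction S arbitrary: a) auto

lemma tiling_le: "tiling M a S b \<Longrightarrow> a \<le> b"
  by (induction S arbitrary: a) force+

lemma tiling_Union: "tiling M a S b \<Longrightarrow> \<Union> (set S) = {a..<b}"
proof (induction S arbitrary: a)
  case (Cons B S)
  then obtain c where "a < c" "B = {a..<c}" "tiling M c S b"
    by auto
  moreover from this have "c \<le> b" by (auto dest: tiling_le)
  ultimately show ?case using Cons.IH[of c] by auto
qed simp

text \<open>The violation supplies the inequality between neighbours that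
  \<open>balanced_merge\<close> requires; all other blocks stay as they are.\<close>

lemma tiling_merge_at:
  assumes avg: "averaging_property n M" and S: "tiling M a S b"
    and ab: "1 \<le> a" "b \<le> Suc n" and viol: "violation M S j"
  shows "tiling M a (merge_at S j) b"
proof -
  define xs P Q ys where "xs = take j S" "P = S ! j" "Q = S ! Suc j" "ys = drop (Suc (Suc j)) S"
  have len: "Suc j < length S" and gt: "M Q < M P"
    using viol by (auto simp: violation_def xs_P_Q_ys_def)
  have "S = xs @ P # Q # ys"
    using len by (metis Cons_nth_drop_Suc Suc_lessD append_take_drop_id xs_P_Q_ys_def)
  with S obtain c d e where
    *: "tiling M a xs c" "c < d" "P = {c..<d}" "balanced M c d"
       "d < e" "Q = {d..<e}" "balanced M d e" "tiling M e ys b"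
    by (auto simp: tiling_append)
  then have "a \<le> c" "e \<le> b" by (auto dest: tiling_le)
  then have "balanced M c e"
    using balanced_merge[OF avg, of c d e] * ab gt by simp
  moreover have "P \<union> Q = {c..<e}" using * by auto
  ultimately have "tiling M a (xs @ (P \<union> Q) # ys) b"
    using * unfolding tiling_append tiling.simps
    by (meson order_less_trans)
  then show ?thesis by (simp add: merge_at_def xs_P_Q_ys_def)
qed

lemma tiling_pava_from:
  assumes "averaging_property n M" "tiling M a S b" "1 \<le> a" "b \<le> Suc n"
  shows "tiling M a (pava_from M S) b"
  using assms
proof (induction M S rule: pava_from.induct)
  case (1 M S)
  show ?case
  proof (cases "\<exists>j. violation M S j")
    case True
    then have "violation M S (LEAST j. violation M S j)" by (rule LeastI_ex)
    from tiling_merge_at[OF "1.prems" this] show ?thesis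
      using "1.IH"[OF True "1.prems"(1)] "1.prems" True by (simp add: pava_from.simps[of M S])
  next
    case False
    with "1.prems" show ?thesis by (simp only: pava_from.simps[of M S] if_False)
  qed
qed

lemma no_violation_pava_from: "\<not> violation M (pava_from M S) j"
proof (induction M S rule: pava_from.induct)
  case (1 M S)
  show ?case
  proof (cases "\<exists>j. violation M S j")
    case True
    with "1.IH" show ?thesis by (simp add: pava_from.simps[of M S])
  next
    case False
    then show ?thesis by (simp only: pava_from.simps[of M S] if_False) blast
  qed
qed

lemma sorted_pava_from: "sorted (map M (pava_from M S))"
  unfolding sorted_iff_nth_Suc
proof (intro allI impI)
  fix i assume "Suc i < length (map M (pava_from M S))"
  with no_violation_pava_from[of M S i]
  show "map M (pava_from M S) ! i \<le> map M (pava_from M S) ! Suc i"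
    by (simp add: violation_def not_less)
qed

lemma tiling_singletons: "a \<le> b \<Longrightarrow> tiling M a (map (\<lambda>j. {j}) [a..<b]) b"
proof (induction b rule: dec_induct)
  case (step b)
  \<comment> \<open>A one-element block has no interior cut, so its balance is vacuous.\<close>
  have "tiling M b [{b}] (Suc b)" by (auto simp: balanced_def)
  with step show ?case by (auto simp: tiling_append simp del: tiling.simps)
qed simp

section \<open>Bounds on prefixes and suffixes of a tiling\<close>

text \<open>Induction strips the first block. If \<open>t\<close> cuts it,
  \<open>balanced_prefix_ge\<close> applies; otherwise averaging joins that block to the rest up to
  \<open>t\<close>, both of value at least \<open>v\<close>.\<close>

lemma tiling_prefix_ge:
  assumes "averaging_property n M" "tiling M a S b" "1 \<le> a" "b \<le> Suc n"
    and "\<And>B. B \<in> set S \<Longrightarrow> v \<le> M B" "a < t" "t \<le> b"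
  shows "v \<le> M {a..<t}"
  using assms
proof (induction S arbitrary: a)
  case (Cons B S)
  then obtain c where c: "a < c" "B = {a..<c}" "balanced M a c" "tiling M c S b"
    by auto
  then have "c \<le> b" by (auto dest: tiling_le)
  have v: "v \<le> M {a..<c}" using Cons.prems(5)[of B] c by simp
  show ?case
  proof (cases "t \<le> c")
    case True
    have "M {a..<c} \<le> M {a..<t}"
      using balanced_prefix_ge[OF Cons.prems(1) c(3)] True Cons.prems \<open>c \<le> b\<close> by simp
    with v show ?thesis by linarith
  next
    case False
    then have "v \<le> M {c..<t}" using Cons.IH[of c] Cons.prems c by simp
    moreover have "min (M {a..<c}) (M {c..<t}) \<le> M {a..<t}"
      using averaging_property_ivl(1)[OF Cons.prems(1)] False Cons.prems c by simp
    ultimately show ?thesis using v by linarith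
  qed
qed simp

lemma tiling_suffix_le:
  assumes "averaging_property n M" "tiling M a S b" "1 \<le> a" "b \<le> Suc n"
    and "\<And>B. B \<in> set S \<Longrightarrow> M B \<le> v" "a \<le> s" "s < b"
  shows "M {s..<b} \<le> v"
  using assms
proof (induction S arbitrary: a s)
  case (Cons B S)
  then obtain c where c: "a < c" "B = {a..<c}" "balanced M a c" "tiling M c S b"
    by auto
  then have "c \<le> b" by (auto dest: tiling_le)
  show ?case
  proof (cases "c \<le> s")
    case True
    then show ?thesis using Cons.IH[of c s] Cons.prems c by simp
  next
    case False
    have "M {s..<c} \<le> M {a..<c}"
      using balanced_suffix_le[OF Cons.prems(1) c(3)] False Cons.prems \<open>c \<le> b\<close> by simp
    then have v: "M {s..<c} \<le> v" using Cons.prems(5)[of B] c by simp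
    \<comment> \<open>Averaging needs a nonempty right piece, so the case of nothing after this
      block is separated; otherwise the induction hypothesis with \<open>s = c\<close> covers all
      remaining blocks.\<close>
    show ?thesis
    proof (cases "c = b")
      case False
      then have "M {c..<b} \<le> v"
        using Cons.IH[of c c] Cons.prems c \<open>c \<le> b\<close> by simp
      moreover have "M {s..<b} \<le> max (M {s..<c}) (M {c..<b})"
        using averaging_property_ivl(2)[OF Cons.prems(1)] \<open>\<not> c \<le> s\<close> False Cons.prems c \<open>c \<le> b\<close>
        by simp
      ultimately show ?thesis using v by linarith
    qed (use v in simp)
  qed
qed simp

section \<open>Locating the block of an index\<close>

text \<open>The tiling of \<open>drop j S\<close> begins with block \<open>j\<close> and that of
  \<open>take (Suc j) S\<close> ends with it, as the prefix and suffix bounds require.\<close>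

lemma tiling_nth:
  assumes "tiling M a S b" "j < length S"
  obtains c d where "S ! j = {c..<d}" "tiling M a (take j S) c" "tiling M c (drop j S) b"
    "tiling M a (take (Suc j) S) d"
proof -
  have "tiling M a (take j S @ S ! j # drop (Suc j) S) b"
    using assms by (simp add: id_take_nth_drop[symmetric])
  then obtain c d where "tiling M a (take j S) c" "c < d" "S ! j = {c..<d}" "balanced M c d"
      "tiling M d (drop (Suc j) S) b"
    by (auto simp: tiling_append)
  then show thesis
    using that[of c d] assms(2)
    by (auto simp: tiling_append take_Suc_conv_app_nth Cons_nth_drop_Suc[symmetric])
qed

text \<open>The blocks before position \<open>k\<close> cover \<open>{a..<c}\<close>, which lies to
  the left of block \<open>k\<close>.\<close>

lemma tiling_nth_disjoint:
  assumes "tiling M a S b" "j < k" "k < length S"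
  shows "S ! j \<inter> S ! k = {}"
proof -
  obtain c d where cd: "tiling M a (take k S) c" "S ! k = {c..<d}"
    using assms by (auto elim: tiling_nth)
  have "S ! j \<in> set (take k S)"
    using assms by (auto simp: in_set_conv_nth)
  then have "S ! j \<subseteq> {a..<c}"
    using tiling_Union[OF cd(1)] by blast
  then show ?thesis using cd(2) by auto
qed

text \<open>Covering gives existence and disjointness gives uniqueness, which justifies the definite
  description in \<open>block_index\<close>.\<close>

lemma block_index_tiling:
  assumes S: "tiling M a S b" and "i \<in> {a..<b}"
  shows "block_index S i < length S" "i \<in> S ! block_index S i"
proof -
  have "\<exists>j. j < length S \<and> i \<in> S ! j"
    using assms tiling_Union[OF S] by (metis UnionE in_set_conv_nth)
  moreover have "j = k" if "j < length S" "i \<in> S ! j" "k < length S" "i \<in> S ! k" for j k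
    using that tiling_nth_disjoint[OF S, of j k] tiling_nth_disjoint[OF S, of k j]
    by (meson disjoint_iff linorder_neqE_nat)
  ultimately have "\<exists>!j. j < length S \<and> i \<in> S ! j" by blast
  from theI'[OF this] show "block_index S i < length S" "i \<in> S ! block_index S i"
    by (simp_all add: block_index_def)
qed

theorem theorem3p3:
  fixes n :: nat and M :: "nat set \<Rightarrow> real"
  assumes "n \<ge> 1"
    and "averaging_property n M"
  shows "\<forall>i\<in>{1..n}. pava_value n M i = (MAX s\<in>{1..i}. MIN t\<in>{i..n}. M {s..t})"
proof
  fix i assume i: "i \<in> {1..n}"
  define S j where "S = pava n M" "j = block_index S i"
  note avg = assms(2)
  have S: "tiling M 1 S (Suc n)"
    unfolding S_j_def pava_def initial_config_def
    by (rule tiling_pava_from[OF avg tiling_singletons]) auto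
  have j: "j < length S" "i \<in> S ! j"
    using block_index_tiling[OF S, of i] i by (auto simp: S_j_def)
  obtain a b where ab: "S ! j = {a..<b}" "tiling M 1 (take j S) a" "tiling M a (drop j S) (Suc n)"
      "tiling M 1 (take (Suc j) S) b"
    using tiling_nth[OF S j(1)] by blast
  have "a \<le> i" "i < b" using ab(1) j(2) by auto
  have "1 \<le> a" using ab(2) by (rule tiling_le)
  have "S ! j \<subseteq> {1..<Suc n}"
    using tiling_Union[OF S] j(1) nth_mem by blast
  then have "b \<le> Suc n"
    using ab(1) \<open>a \<le> i\<close> \<open>i < b\<close> by (simp add: ivl_subset)
  have sorted: "M (S ! k) \<le> M (S ! l)" if "k \<le> l" "l < length S" for k l
    using sorted_nth_mono[OF sorted_pava_from[of M "initial_config n"] that(1)] that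
    by (simp add: S_j_def pava_def)
  \<comment> \<open>The tiling by \<open>drop j S\<close> starts at \<open>a\<close>, and by
    sortedness its blocks have values at least that of block \<open>j\<close>.\<close>
  have lower: "M {a..<b} \<le> M {a..t}" if "t \<in> {i..n}" for t
  proof -
    have "M {a..<b} \<le> M {a..<Suc t}"
    proof (rule tiling_prefix_ge[OF avg ab(3)])
      fix B assume "B \<in> set (drop j S)"
      then obtain k where "k < length S - j" "B = S ! (j + k)"
        by (auto simp: in_set_conv_nth)
      then show "M {a..<b} \<le> M B" using sorted[of j "j + k"] ab(1) by simp
    qed (use that \<open>a \<le> i\<close> \<open>1 \<le> a\<close> in auto)
    then show ?thesis by (simp add: atLeastLessThanSuc_atLeastAtMost)
  qed
  \<comment> \<open>Dually, the tiling by \<open>take (Suc j) S\<close> ends at \<open>b\<close>,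
    and its blocks have values at most that of block \<open>j\<close>.\<close>
  have upper: "M {s..<b} \<le> M {a..<b}" if "s \<in> {1..i}" for s
  proof (rule tiling_suffix_le[OF avg ab(4)])
    fix B assume "B \<in> set (take (Suc j) S)"
    then obtain k where "k \<le> j" "B = S ! k"
      by (auto simp: in_set_conv_nth less_Suc_eq_le)
    then show "M B \<le> M {a..<b}" using sorted[of k j] ab(1) j(1) by simp
  qed (use that \<open>i < b\<close> \<open>b \<le> Suc n\<close> in auto)
  \<comment> \<open>The subtraction is exact, since \<open>i < b\<close> makes \<open>b\<close>
    positive.\<close>
  have b: "{s..<b} = {s..b - 1}" for s
    using \<open>i < b\<close> by auto
  have b_mem: "b - 1 \<in> {i..n}"
    using \<open>i < b\<close> \<open>b \<le> Suc n\<close> by auto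
  have "(MAX s\<in>{1..i}. MIN t\<in>{i..n}. M {s..t}) = M {a..<b}"
  proof (rule antisym)
    have "(MIN t\<in>{i..n}. M {s..t}) \<le> M {a..<b}" if "s \<in> {1..i}" for s
    proof -
      \<comment> \<open>The right end of the block, \<open>t = b - 1\<close>, serves as witness for
        every \<open>s\<close>.\<close>
      have "(MIN t\<in>{i..n}. M {s..t}) \<le> M {s..b - 1}" using b_mem by (intro Min_le) auto
      with upper[OF that] show ?thesis by (simp add: b)
    qed
    then show "(MAX s\<in>{1..i}. MIN t\<in>{i..n}. M {s..t}) \<le> M {a..<b}"
      using i by (subst Max_le_iff) auto
    have "M {a..<b} \<le> (MIN t\<in>{i..n}. M {a..t})"
      using i lower by (subst Min_ge_iff) auto
    \<comment> \<open>The outer maximum is bounded below by its term at \<open>s = a\<close>, the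
      left end of the block.\<close>
    also have "\<dots> \<le> (MAX s\<in>{1..i}. MIN t\<in>{i..n}. M {s..t})"
      using \<open>1 \<le> a\<close> \<open>a \<le> i\<close> by (intro Max_ge) auto
    finally show "M {a..<b} \<le> (MAX s\<in>{1..i}. MIN t\<in>{i..n}. M {s..t})" .
  qed
  then show "pava_value n M i = (MAX s\<in>{1..i}. MIN t\<in>{i..n}. M {s..t})"
    using ab(1) by (simp add: pava_value_def S_j_def)
qed

end
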